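(* Let $f,g:\mathbb{R}^n\to(-\infty,\infty]$ be proper, convex, lower semicontinuous functions with $(\partial f+\partial g)^{-1}(0)\ne\emptyset$, and suppose an $\mathcal{F}$-procedure for $f$ (see context) is given. Consider any execution of Algorithm 3 (see context) for which $\alpha\in[0,1)$, $\overline\rho\in(0,2)$ and $\{\alpha_k\}$ satisfy, for some $\beta>0$, $0\le\alpha_k\le\alpha_{k+1}\le\alpha<\beta<1$ for all $k\ge0$, and $\overline\rho=\dfrac{2(\beta-1)^2}{2(\beta-1)^2+3\beta-1}$. Then: (a) If the outer loop (over $k$) executes an infinite number of times, with each inner loop (over $\ell$) terminating in a finite number of iterations $\ell=\ell(k)$, then $\{x^k\}$ and $\{z^k\}$ both converge to some $x^*\in\mathbb{R}^n$ with $0\in\partial f(x^* )+\partial g(x^* )$, and $\{p^k\}$ converges to some $p^*\in\partial g(x^* )$ such that $-p^*\in\partial f(x^* )$. (b) If the outer loop executes only a finite number of times, ending with $k=\bar k$, with the last invocation of the inner loop executing an infinite number of times, then $\{x^{\bar k,\ell}\}_\ell$ and $\{z^{\bar k,\ell}\}_\ell$ both converge to some $x^*\in\mathbb{R}^n$ with $0\in\partial f(x^* )+\partial g(x^* )$, and $\{p^{\bar k,\ell}\}_\ell$ converges to some $p^*\in\partial g(x^* )$ such that $-p^*\in\partial f(x^* )$. (c) If Algorithm 3 stops with either $p^{k,\ell}-\hat p^k=c(z^{k,\ell}-\hat z^k)$ or $x^{k,\ell}=z^{k,\ell}$, then $x^*:=x^{k,\ell}=z^{k,\ell}$ satisfies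 $0\in\partial f(x^* )+\partial g(x^* )$.
   Context: $\mathbb{N}^*=\{1,2,\dots\}$, $\mathbb{R}_{++}=(0,\infty)$; $\langle\cdot,\cdot\rangle,\|\cdot\|$ are Euclidean; $\partial$ is the convex subdifferential. $\mathcal{F}$-procedure (for $f$): a mapping $\mathcal{F}=(\mathcal{F}_1,\mathcal{F}_2):\mathbb{R}^n\times\mathbb{R}^n\times\mathbb{R}_{++}\times\mathbb{R}^n\times\mathbb{N}^*\to\mathbb{R}^n\times\mathbb{R}^n$ such that for any $p,z,\bar x\in\mathbb{R}^n$ and $c>0$, letting $(x^\ell,y^\ell)=\mathcal{F}(p,z,c,\bar x,\ell)$ for all $\ell\in\mathbb{N}^*$, one has $\lim_{\ell\to\infty}y^\ell=0$ and, for all $\ell$, $y^\ell\in\partial_x\left[f(x)+\langle p,x\rangle+\frac c2\|x-z\|^2\right]_{x=x^\ell}$. Algorithm 3 (partially inexact relative-error inertial-relaxed ADMM for minimizing $f+g$). Choose $c>0$, $0\le\alpha,\sigma<1$, $0<\underline\rho<\overline\rho<2$, and $(x^0,z^0,p^0)=(x^{-1},z^{-1},p^{-1})\in(\mathbb{R}^n)^3$. For $k=0,1,2,\dots$ (outer loop): (1) choose $\alpha_k\in[0,\alpha]$ and set $(\hat x^k,\hat z^k,\hat p^k)=(x^k,z^k,p^k)+\alpha_k[(x^k,z^k,p^k)-(x^{k-1},z^{k-1},p^{k-1})]$; (2) (inner loop) repeat for $\ell=1,2,\dots$: set $(x^{k,\ell},y^{k,\ell})=\mathcal{F}(\hat p^k,\hat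 z^k,c,\hat x^k,\ell)$, $p^{k,\ell}=\hat p^k+c(x^{k,\ell}-\hat z^k)-y^{k,\ell}$, and (exactly) $z^{k,\ell}=\operatorname{argmin}_{z\in\mathbb{R}^n}\{g(z)-\langle p^{k,\ell},z\rangle+\frac c2\|x^{k,\ell}-z\|^2\}$; until $$\|y^{k,\ell}\|^2\le\sigma^2\left(\|p^{k,\ell}-\hat p^k-c(z^{k,\ell}-\hat z^k)\|^2+c^2\|x^{k,\ell}-z^{k,\ell}\|^2\right);$$ (3) with $\ell=\ell(k)$ the terminating inner index: if $x^{k,\ell}=z^{k,\ell}$, stop; otherwise choose $\rho_k\in[\underline\rho,\overline\rho]$ and set $x^{k+1}=x^{k,\ell}$, $z^{k+1}=z^{k,\ell}$, $$\theta_{k+1}=\frac{\langle c(\hat z^k-z^{k,\ell})-(\hat p^k-p^{k,\ell}),\,x^{k,\ell}-z^{k,\ell}\rangle}{c\|x^{k,\ell}-z^{k,\ell}\|^2},$$ $$p^{k+1}=\hat p^k+c\left[(1-\rho_k\theta_{k+1})z^{k+1}+\rho_k\theta_{k+1}x^{k+1}-\hat z^k\right].$$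
   Formalization: Part (b) is proved only for σ > 0; for σ = 0 it is false: with n = 1, f = g = x²/2, c = 1, x⁰ = z⁰ = 1, p⁰ = 0, α_k = 0 and an F-procedure with y^ℓ = 1/ℓ, the inner loop never ends, x^{0,ℓ} → 1/2 and z^{0,ℓ} → 0. *)

theory Defs
  imports "HOL-Analysis.Analysis" "HOL-Library.Extended_Nat"
begin

definition proper_fun :: "('a \<Rightarrow> ereal) \<Rightarrow> bool" where
  "proper_fun f \<longleftrightarrow> (\<forall>x. f x \<noteq> -\<infinity>) \<and> (\<exists>x. f x \<noteq> \<infinity>)"

text \<open>Only meant for functions that avoid \<open>-\<infinity>\<close>, so that the right-hand side is never
  \<open>\<infinity> - \<infinity>\<close>; recall \<open>0 * \<infinity> = 0\<close> in \<^typ>\<open>ereal\<close>.\<close>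

definition convex_fun :: "('a::real_vector \<Rightarrow> ereal) \<Rightarrow> bool" where
  "convex_fun f \<longleftrightarrow> (\<forall>x y. \<forall>u\<ge>0. \<forall>v\<ge>0. u + v = 1 \<longrightarrow>
     f (u *\<^sub>R x + v *\<^sub>R y) \<le> ereal u * f x + ereal v * f y)"

definition lsc_fun :: "('a::topological_space \<Rightarrow> ereal) \<Rightarrow> bool" where
  "lsc_fun f \<longleftrightarrow> (\<forall>x. f x \<le> Liminf (at x) f)"

text \<open>For proper \<open>f\<close> this set is empty wherever \<open>f\<close> is infinite.\<close>

definition subdiff :: "('a::real_inner \<Rightarrow> ereal) \<Rightarrow> 'a \<Rightarrow> 'a set" where
  "subdiff f x = {v. \<forall>y. f x + ereal (v \<bullet> (y - x)) \<le> f y}"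

definition F_procedure ::
  "('a::real_inner \<Rightarrow> ereal) \<Rightarrow> ('a \<Rightarrow> 'a \<Rightarrow> real \<Rightarrow> 'a \<Rightarrow> nat \<Rightarrow> 'a \<times> 'a) \<Rightarrow> bool" where
  "F_procedure f F \<longleftrightarrow> (\<forall>p z c xbar. 0 < c \<longrightarrow>
     (\<lambda>l. snd (F p z c xbar l)) \<longlonglongrightarrow> 0 \<and>
     (\<forall>l\<ge>1. snd (F p z c xbar l) \<in>
        subdiff (\<lambda>x. f x + ereal (p \<bullet> x + c / 2 * (norm (x - z))\<^sup>2)) (fst (F p z c xbar l))))"

text \<open>
  The data of one run of the algorithm.
  \<open>outer_len\<close> is the number of outer iterations started, so the iterations \<open>k\<close> with
  \<open>enat k < outer_len\<close> are the ones executed. \<open>inner_len k\<close> is the number of inner iterations performed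
  in outer iteration \<open>k\<close>; a finite value is the terminating index (the inner loop is numbered
  from 1), and \<open>\<infinity>\<close> says that the inner loop never terminates.
  \<open>X\<close>, \<open>Z\<close>, \<open>P\<close> are the outer iterates, \<open>xin k l\<close>, \<open>yin k l\<close>, \<open>zin k l\<close>, \<open>pin k l\<close> the inner
  ones. Values at indices that are not executed carry no meaning.\<close>

record 'a run =
  outer_len :: enat
  inner_len :: "nat \<Rightarrow> enat"
  alphas :: "nat \<Rightarrow> real"
  rhos :: "nat \<Rightarrow> real"
  X :: "nat \<Rightarrow> 'a"
  Z :: "nat \<Rightarrow> 'a"
  P :: "nat \<Rightarrow> 'a"
  xin :: "nat \<Rightarrow> nat \<Rightarrow> 'a"
  yin :: "nat \<Rightarrow> nat \<Rightarrow> 'a"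
  zin :: "nat \<Rightarrow> nat \<Rightarrow> 'a"
  pin :: "nat \<Rightarrow> nat \<Rightarrow> 'a"

text \<open>Truncated subtraction makes \<open>u (0 - 1) = u 0\<close>, which is the convention that the iterates with
  index -1 coincide with those with index 0.\<close>

definition extrapolate :: "(nat \<Rightarrow> real) \<Rightarrow> (nat \<Rightarrow> 'a::real_vector) \<Rightarrow> nat \<Rightarrow> 'a" where
  "extrapolate a u k = u k + a k *\<^sub>R (u k - u (k - 1))"

definition xhat :: "('a::real_vector) run \<Rightarrow> nat \<Rightarrow> 'a" where
  "xhat R = extrapolate (alphas R) (X R)"

definition zhat :: "('a::real_vector) run \<Rightarrow> nat \<Rightarrow> 'a" where
  "zhat R = extrapolate (alphas R) (Z R)"

definition phat :: "('a::real_vector) run \<Rightarrow> nat \<Rightarrow> 'a" where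
  "phat R = extrapolate (alphas R) (P R)"

definition inner_step ::
  "('a::real_inner \<Rightarrow> ereal) \<Rightarrow> ('a \<Rightarrow> 'a \<Rightarrow> real \<Rightarrow> 'a \<Rightarrow> nat \<Rightarrow> 'a \<times> 'a) \<Rightarrow> real \<Rightarrow>
   'a run \<Rightarrow> nat \<Rightarrow> nat \<Rightarrow> bool" where
  "inner_step g F c R k l \<longleftrightarrow>
     (xin R k l, yin R k l) = F (phat R k) (zhat R k) c (xhat R k) l \<and>
     pin R k l = phat R k + c *\<^sub>R (xin R k l - zhat R k) - yin R k l \<and>
     is_arg_min (\<lambda>z. g z + ereal (- (pin R k l \<bullet> z) + c / 2 * (norm (xin R k l - z))\<^sup>2))
       (\<lambda>_. True) (zin R k l)"

definition inner_test :: "real \<Rightarrow> real \<Rightarrow> ('a::real_inner) run \<Rightarrow> nat \<Rightarrow> nat \<Rightarrow> bool" where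
  "inner_test c \<sigma> R k l \<longleftrightarrow>
     (norm (yin R k l))\<^sup>2 \<le> \<sigma>\<^sup>2 *
       ((norm (pin R k l - phat R k - c *\<^sub>R (zin R k l - zhat R k)))\<^sup>2 +
        c\<^sup>2 * (norm (xin R k l - zin R k l))\<^sup>2)"

text \<open>\<open>theta c R k l\<close> is the number \<open>\<theta>\<^bsub>k+1\<^esub>\<close> computed at the end of outer iteration \<open>k\<close>, whose inner
  loop stopped at index \<open>l\<close>.\<close>

definition theta :: "real \<Rightarrow> ('a::real_inner) run \<Rightarrow> nat \<Rightarrow> nat \<Rightarrow> real" where
  "theta c R k l =
     ((c *\<^sub>R (zhat R k - zin R k l) - (phat R k - pin R k l)) \<bullet> (xin R k l - zin R k l)) /
     (c * (norm (xin R k l - zin R k l))\<^sup>2)"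

definition outer_update ::
  "real \<Rightarrow> real \<Rightarrow> real \<Rightarrow> ('a::real_inner) run \<Rightarrow> nat \<Rightarrow> nat \<Rightarrow> bool" where
  "outer_update c \<rho>lo \<rho>hi R k l \<longleftrightarrow>
     rhos R k \<in> {\<rho>lo..\<rho>hi} \<and>
     X R (Suc k) = xin R k l \<and>
     Z R (Suc k) = zin R k l \<and>
     P R (Suc k) = phat R k + c *\<^sub>R
       ((1 - rhos R k * theta c R k l) *\<^sub>R Z R (Suc k)
        + (rhos R k * theta c R k l) *\<^sub>R X R (Suc k) - zhat R k)"

text \<open>In each executed outer iteration, the inner loop stops exactly at the first index that passes
  the test. The next outer iteration is started if and only if the inner loop terminates, at
  index \<open>l\<close> say, with \<open>xin R k l \<noteq> zin R k l\<close>; so runs are maximal.\<close>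

definition admm_run ::
  "('a::real_inner \<Rightarrow> ereal) \<Rightarrow> ('a \<Rightarrow> 'a \<Rightarrow> real \<Rightarrow> 'a \<Rightarrow> nat \<Rightarrow> 'a \<times> 'a) \<Rightarrow>
   real \<Rightarrow> real \<Rightarrow> real \<Rightarrow> real \<Rightarrow> real \<Rightarrow> 'a run \<Rightarrow> bool" where
  "admm_run g F c \<alpha> \<sigma> \<rho>lo \<rho>hi R \<longleftrightarrow>
     0 < c \<and> 0 \<le> \<alpha> \<and> \<alpha> < 1 \<and> 0 \<le> \<sigma> \<and> \<sigma> < 1 \<and> 0 < \<rho>lo \<and> \<rho>lo < \<rho>hi \<and> \<rho>hi < 2 \<and>
     0 < outer_len R \<and>
     (\<forall>k. enat k < outer_len R \<longrightarrow>
        alphas R k \<in> {0..\<alpha>} \<and>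
        1 \<le> inner_len R k \<and>
        (\<forall>l\<ge>1. enat l \<le> inner_len R k \<longrightarrow>
           inner_step g F c R k l \<and> (inner_test c \<sigma> R k l \<longleftrightarrow> inner_len R k = enat l)) \<and>
        (enat (Suc k) < outer_len R \<longleftrightarrow>
           (\<exists>l. inner_len R k = enat l \<and> xin R k l \<noteq> zin R k l)) \<and>
        (\<forall>l. inner_len R k = enat l \<and> xin R k l \<noteq> zin R k l \<longrightarrow> outer_update c \<rho>lo \<rho>hi R k l))"

end

theory Submission
  imports Defs
begin

text \<open>The algorithm is a perturbed Douglas--Rachford iteration in the single vector
  \<open>w\<^sub>k = c z\<^sup>k - p\<^sup>k\<close>. Call \<open>(x, p)\<close> a Kuhn--Tucker pair if \<open>p \<in> \<partial>g(x)\<close> and \<open>-p \<in> \<partial>f(x)\<close>; every such pair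
  gives a target \<open>s = c x - p\<close>. Let \<open>h\<close> be the extrapolation of \<open>w\<close>. An inner step yields \<open>x, z, p\<close> with
  \<open>-p \<in> \<partial>f(x)\<close>, \<open>p + c (x - z) \<in> \<partial>g(z)\<close> and \<open>c x - p = h + y\<close>, where \<open>y\<close> is the error
  (\<open>inner_step_KT\<close>). Monotonicity of the two subdifferentials puts all targets \<open>s\<close> in the half-space
  \<open>\<langle>s - (c z - p), x - z\<rangle> \<le> 0\<close> (\<open>KT_separation\<close>), and the outer update is exactly the projection of
  \<open>h\<close> onto the bounding hyperplane, relaxed by \<open>\<rho>\<^sub>k\<close>: the number \<open>\<theta>\<close> is the projection coefficient.

  Since \<open>y\<close> is the difference of \<open>v = c (x - z)\<close> and \<open>d = h - (c z - p)\<close>, the inner test is a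
  relative bound on the gap between \<open>d\<close> and \<open>v\<close>. It forces the two to have a positive inner product,
  so that the projection step dominates both residuals
  (\<open>relative_error_controls_projection\<close>). Hence the distance to each target decreases up to the
  inertial term. The relation between \<open>\<beta>\<close> and the largest relaxation parameter says precisely that
  the decrease outweighs this term when \<open>\<alpha> < \<beta>\<close>, and then the distances
  converge and the steps vanish (\<open>inertial_Fejer_sequence\<close>).

  What remains is to identify limits. Monotonicity of \<open>\<partial>f\<close> makes \<open>x\<close> a Lipschitz function of
  \<open>c x - p\<close>, so convergence of the latter together with \<open>x - z \<longlonglongrightarrow> 0\<close> gives a Kuhn--Tucker pair in the
  limit (\<open>approximate_KT_pairs_converge\<close>). Applied to a convergent subsequence of \<open>w\<close>, this shows that
  its limit is a target; as distances to targets converge, all of \<open>w\<close> converges to it, and a second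
  application recovers \<open>x\<close>, \<open>z\<close> and \<open>p\<close>. When an inner loop does not end, \<open>h\<close> is constant, \<open>y\<close> tends
  to zero and the failing tests force \<open>x - z \<longlonglongrightarrow> 0\<close>, so the same lemma applies directly. At a stop,
  the test turns \<open>d = 0\<close> into \<open>v = 0\<close>, and \<open>x = z\<close> makes \<open>(x, p)\<close> a Kuhn--Tucker pair.\<close>

section \<open>Subgradients\<close>

lemma subdiff_imp_finite:
  assumes "proper_fun f" "v \<in> subdiff f x"
  obtains r where "f x = ereal r"
proof -
  obtain y where y: "f y \<noteq> \<infinity>" and "f x \<noteq> -\<infinity>"
    using assms(1) unfolding proper_fun_def by auto
  moreover have "f x + ereal (v \<bullet> (y - x)) \<le> f y"
    using assms(2) unfolding subdiff_def by blast
  ultimately show thesis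
    by (cases "f x") (auto intro: that)
qed

lemma subdiff_monotone:
  assumes "proper_fun f" "v \<in> subdiff f x" "w \<in> subdiff f y"
  shows "0 \<le> (v - w) \<bullet> (x - y)"
proof -
  obtain r s where rs: "f x = ereal r" "f y = ereal s"
    using subdiff_imp_finite assms by metis
  have "r + v \<bullet> (y - x) \<le> s" "s + w \<bullet> (x - y) \<le> r"
    using assms(2,3) rs unfolding subdiff_def by (metis (mono_tags, lifting) ereal_less_eq(3) mem_Collect_eq plus_ereal.simps(1))+
  then show ?thesis
    by (simp add: inner_diff_left inner_diff_right)
qed

lemma lsc_fun_eventually_gt:
  assumes "lsc_fun f" "r < f x" "u \<longlonglongrightarrow> x"
  shows "eventually (\<lambda>n. r < f (u n)) sequentially"
proof -
  have "r < Liminf (at x) f"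
    using assms(1,2) unfolding lsc_fun_def by (meson less_le_trans)
  then have "eventually (\<lambda>y. r < f y) (at x)"
    by (rule less_LiminfD)
  then have "eventually (\<lambda>y. y \<noteq> x \<longrightarrow> r < f y) (nhds x)"
    by (simp add: eventually_at_filter)
  then have "eventually (\<lambda>n. u n \<noteq> x \<longrightarrow> r < f (u n)) sequentially"
    using assms(3) by (auto simp: filterlim_iff)
  then show ?thesis
    by (rule eventually_mono) (use assms(2) in auto)
qed

text \<open>The value \<open>f x\<close> is not known to be finite beforehand. The subgradient inequality is therefore passed
  to the limit for every real \<open>r < f x\<close> in place of \<open>f x\<close>, which lower semicontinuity
  allows.\<close>

lemma subdiff_closed_graph:
  fixes f :: "'a::real_inner \<Rightarrow> ereal"
  assumes lsc: "lsc_fun f" and sub: "\<And>n. v n \<in> subdiff f (u n)"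
    and u: "u \<longlonglongrightarrow> x" and v: "v \<longlonglongrightarrow> w"
  shows "w \<in> subdiff f x"
proof -
  have "f x + ereal (w \<bullet> (y - x)) \<le> f y" for y
  proof -
    have bound: "ereal r + ereal (w \<bullet> (y - x)) \<le> f y" if "ereal r < f x" for r
    proof -
      have lim: "(\<lambda>n. ereal (r + v n \<bullet> (y - u n))) \<longlonglongrightarrow> ereal (r + w \<bullet> (y - x))"
        using u v by (intro tendsto_intros)
      have "eventually (\<lambda>n. ereal (r + v n \<bullet> (y - u n)) \<le> f y) sequentially"
        using lsc_fun_eventually_gt[OF lsc that u]
      proof (rule eventually_mono)
        fix n assume "ereal r < f (u n)"
        then have "ereal r + ereal (v n \<bullet> (y - u n)) \<le> f (u n) + ereal (v n \<bullet> (y - u n))"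
          by (intro add_mono) auto
        also have "\<dots> \<le> f y" using sub[of n] unfolding subdiff_def by blast
        finally show "ereal (r + v n \<bullet> (y - u n)) \<le> f y" by simp
      qed
      then have "ereal (r + w \<bullet> (y - x)) \<le> f y"
        using tendsto_le[OF _ tendsto_const lim] by simp
      then show ?thesis by simp
    qed
    have "f x \<le> f y - ereal (w \<bullet> (y - x))"
    proof (rule dense_le)
      fix t assume t: "t < f x"
      show "t \<le> f y - ereal (w \<bullet> (y - x))"
      proof (cases t)
        case (real r)
        then show ?thesis using bound[of r] t by (simp add: ereal_le_minus)
      next
        case PInf
        then show ?thesis using t by auto
      next
        case MInf
        then show ?thesis by simp
      qed
    qed
    then show ?thesis by (simp add: ereal_le_minus)
  qed
  then show ?thesis unfolding subdiff_def by blast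
qed

text \<open>The subdifferential sum rule for a quadratic summand. Convexity of \<open>f\<close> lets
  the inequality be tested along a segment \<open>x + t (y - x)\<close>; after division by \<open>t\<close> the second-order
  part of the quadratic is of order \<open>t\<close> and vanishes as \<open>t\<close> tends to 0.\<close>

lemma subdiff_quadratic_perturbation:
  fixes f :: "'a::real_inner \<Rightarrow> ereal"
  assumes proper: "proper_fun f" and conv: "convex_fun f"
    and sub: "v \<in> subdiff (\<lambda>u. f u + ereal (q \<bullet> u + c / 2 * (norm (u - z))\<^sup>2)) x"
  shows "v - q - c *\<^sub>R (x - z) \<in> subdiff f x"
proof -
  define Q where "Q u = q \<bullet> u + c / 2 * (norm (u - z))\<^sup>2" for u
  have subQ: "f x + ereal (Q x) + ereal (v \<bullet> (y - x)) \<le> f y + ereal (Q y)" for y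
    using sub unfolding subdiff_def Q_def by blast
  have nm: "f u \<noteq> -\<infinity>" for u
    using proper unfolding proper_fun_def by blast
  obtain u0 where "f u0 \<noteq> \<infinity>"
    using proper unfolding proper_fun_def by blast
  then obtain r where r: "f x = ereal r"
    using subQ[of u0] nm by (cases "f x") auto
  have "f x + ereal ((v - q - c *\<^sub>R (x - z)) \<bullet> (y - x)) \<le> f y" for y
  proof (cases "f y")
    case PInf
    then show ?thesis by simp
  next
    case MInf
    then show ?thesis using nm by blast
  next
    case (real s)
    define d where "d = y - x"
    have ineq: "(v - q - c *\<^sub>R (x - z)) \<bullet> d - c / 2 * t * (norm d)\<^sup>2 \<le> s - r"
      if t: "0 < t" "t \<le> 1" for t
    proof -
      have "f ((1 - t) *\<^sub>R x + t *\<^sub>R y) \<le> ereal (1 - t) * f x + ereal t * f y"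
        using conv t unfolding convex_fun_def by simp
      moreover have "(1 - t) *\<^sub>R x + t *\<^sub>R y = x + t *\<^sub>R d"
        by (simp add: d_def algebra_simps)
      ultimately have "f (x + t *\<^sub>R d) \<le> ereal ((1 - t) * r + t * s)"
        by (simp add: r real)
      then have "f (x + t *\<^sub>R d) + ereal (Q (x + t *\<^sub>R d))
          \<le> ereal ((1 - t) * r + t * s) + ereal (Q (x + t *\<^sub>R d))"
        by (rule add_right_mono)
      then have "f x + ereal (Q x) + ereal (v \<bullet> (t *\<^sub>R d))
          \<le> ereal ((1 - t) * r + t * s) + ereal (Q (x + t *\<^sub>R d))"
        using subQ[of "x + t *\<^sub>R d"] by simp
      then have "ereal (r + Q x + v \<bullet> (t *\<^sub>R d)) \<le> ereal ((1 - t) * r + t * s + Q (x + t *\<^sub>R d))"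
        by (simp add: r)
      then have 1: "r + Q x + t * (v \<bullet> d) \<le> (1 - t) * r + t * s + Q (x + t *\<^sub>R d)"
        by simp
      have sq: "(norm (x + t *\<^sub>R d - z))\<^sup>2
          = (norm (x - z))\<^sup>2 + 2 * t * ((x - z) \<bullet> d) + t\<^sup>2 * (norm d)\<^sup>2"
        unfolding power2_norm_eq_inner by (simp add: algebra_simps inner_commute power2_eq_square)
      have "Q (x + t *\<^sub>R d)
          = Q x + t * ((q + c *\<^sub>R (x - z)) \<bullet> d) + c / 2 * t\<^sup>2 * (norm d)\<^sup>2"
        unfolding Q_def sq by (simp add: algebra_simps)
      with 1 have "t * ((v - q - c *\<^sub>R (x - z)) \<bullet> d - c / 2 * t * (norm d)\<^sup>2) \<le> t * (s - r)"
        by (simp add: algebra_simps power2_eq_square)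
      then show ?thesis using t by simp
    qed
    have "((\<lambda>t. (v - q - c *\<^sub>R (x - z)) \<bullet> d - c / 2 * t * (norm d)\<^sup>2)
        \<longlongrightarrow> (v - q - c *\<^sub>R (x - z)) \<bullet> d - c / 2 * 0 * (norm d)\<^sup>2) (at_right 0)"
      by (intro tendsto_intros)
    moreover have "eventually (\<lambda>t. (v - q - c *\<^sub>R (x - z)) \<bullet> d - c / 2 * t * (norm d)\<^sup>2 \<le> s - r)
        (at_right 0)"
      using eventually_at_right_less[of "0::real"] eventually_at_right[of 0 "1::real"] ineq
      by (auto intro: exI[of _ 1])
    ultimately have "(v - q - c *\<^sub>R (x - z)) \<bullet> d - c / 2 * 0 * (norm d)\<^sup>2 \<le> s - r"
      by (intro tendsto_upperbound) auto
    then show ?thesis by (simp add: r real d_def)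
  qed
  then show ?thesis unfolding subdiff_def by blast
qed

lemma subdiff_of_proximal_argmin:
  fixes g :: "'a::real_inner \<Rightarrow> ereal"
  assumes "proper_fun g" "convex_fun g"
    and min: "is_arg_min (\<lambda>u. g u + ereal (- (p \<bullet> u) + c / 2 * (norm (x - u))\<^sup>2)) (\<lambda>_. True) z"
  shows "p + c *\<^sub>R (x - z) \<in> subdiff g z"
proof -
  have "0 \<in> subdiff (\<lambda>u. g u + ereal ((- p) \<bullet> u + c / 2 * (norm (u - x))\<^sup>2)) z"
    using min unfolding is_arg_min_def subdiff_def by (auto simp: norm_minus_commute not_less)
  from subdiff_quadratic_perturbation[OF assms(1,2) this] show ?thesis
    by (simp add: algebra_simps)
qed

section \<open>Limits of approximate Kuhn--Tucker pairs\<close>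

text \<open>If \<open>-p \<in> \<partial>f(x)\<close> then \<open>x\<close> is the resolvent of \<open>\<partial>f\<close> at \<open>c x - p\<close>. Resolvents are Lipschitz with
  constant \<open>1 / c\<close>, so \<open>x\<close> inherits the Cauchy property from \<open>c x - p\<close>; the other limits then follow
  by algebra, and the inclusions from closedness of the graphs.\<close>

lemma approximate_KT_pairs_converge:
  fixes x z p :: "nat \<Rightarrow> 'a::{real_inner, complete_space}"
  assumes f: "proper_fun f" "lsc_fun f" and g: "lsc_fun g" and c: "0 < c"
    and xf: "\<And>n. - p n \<in> subdiff f (x n)"
    and zg: "\<And>n. p n + c *\<^sub>R (x n - z n) \<in> subdiff g (z n)"
    and xz: "(\<lambda>n. x n - z n) \<longlonglongrightarrow> 0"
    and w: "(\<lambda>n. c *\<^sub>R x n - p n) \<longlonglongrightarrow> w"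
  obtains xs ps where "x \<longlonglongrightarrow> xs" "z \<longlonglongrightarrow> xs" "p \<longlonglongrightarrow> ps"
    "ps \<in> subdiff g xs" "- ps \<in> subdiff f xs" "w = c *\<^sub>R xs - ps"
proof -
  let ?u = "\<lambda>n. c *\<^sub>R x n - p n"
  have lip: "c * norm (x m - x n) \<le> norm (?u m - ?u n)" for m n
  proof -
    have "c * (norm (x m - x n))\<^sup>2 \<le> (?u m - ?u n) \<bullet> (x m - x n)"
      using subdiff_monotone[OF f(1) xf[of m] xf[of n]]
      by (simp add: power2_norm_eq_inner algebra_simps)
    also have "\<dots> \<le> norm (?u m - ?u n) * norm (x m - x n)"
      by (rule norm_cauchy_schwarz)
    finally have "(c * norm (x m - x n)) * norm (x m - x n) \<le> norm (?u m - ?u n) * norm (x m - x n)"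
      by (simp add: power2_eq_square mult.assoc)
    then show ?thesis
      by (cases "x m = x n") auto
  qed
  have "Cauchy x"
  proof (rule metric_CauchyI)
    fix e :: real assume "0 < e"
    then obtain M where "\<And>m n. M \<le> m \<Longrightarrow> M \<le> n \<Longrightarrow> dist (?u m) (?u n) < c * e"
      using metric_CauchyD[OF LIMSEQ_imp_Cauchy[OF w], of "c * e"] c by auto
    then have "c * norm (x m - x n) < c * e" if "M \<le> m" "M \<le> n" for m n
      using lip[of m n] that unfolding dist_norm by (meson le_less_trans)
    then show "\<exists>M. \<forall>m\<ge>M. \<forall>n\<ge>M. dist (x m) (x n) < e"
      using c unfolding dist_norm by auto
  qed
  then obtain xs where x: "x \<longlonglongrightarrow> xs"
    using Cauchy_convergent convergent_def by blast
  have z: "z \<longlonglongrightarrow> xs"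
    using tendsto_diff[OF x xz] by simp
  have p: "p \<longlonglongrightarrow> c *\<^sub>R xs - w"
    using tendsto_diff[OF tendsto_scaleR[OF tendsto_const[of c] x] w] by simp
  have "(\<lambda>n. p n + c *\<^sub>R (x n - z n)) \<longlonglongrightarrow> (c *\<^sub>R xs - w) + c *\<^sub>R 0"
    by (intro tendsto_intros p xz)
  then have "c *\<^sub>R xs - w \<in> subdiff g xs"
    using subdiff_closed_graph[OF g zg z] by simp
  moreover have "- (c *\<^sub>R xs - w) \<in> subdiff f xs"
    by (rule subdiff_closed_graph[OF f(2) xf x]) (intro tendsto_minus p)
  ultimately show thesis
    using that[OF x z p] by simp
qed

lemma KT_pair_imp_solution: "\<lbrakk>p \<in> subdiff g x; - p \<in> subdiff f x\<rbrakk> \<Longrightarrow> 0 \<in> subdiff f x + subdiff g x"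
  by (metis add.left_inverse set_plus_intro)

section \<open>Relaxed projections\<close>

text \<open>Expanding the square turns the error bound into
  \<open>(1 - \<sigma>\<^sup>2) (\<parallel>d\<parallel>\<^sup>2 + \<parallel>v\<parallel>\<^sup>2) \<le> 2 \<langle>d, v\<rangle> = 2 \<parallel>a\<parallel> \<parallel>v\<parallel>\<close>, and the sum of squares dominates both
  \<open>\<parallel>v\<parallel> \<parallel>v\<parallel>\<close> and \<open>\<parallel>d\<parallel> \<parallel>v\<parallel>\<close>.\<close>

lemma relative_error_controls_projection:
  fixes d v :: "'a::real_inner"
  assumes err: "(norm (d - v))\<^sup>2 \<le> \<sigma>\<^sup>2 * ((norm d)\<^sup>2 + (norm v)\<^sup>2)"
    and \<sigma>: "0 \<le> \<sigma>" "\<sigma> < 1" and v: "v \<noteq> 0"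
  defines "a \<equiv> (d \<bullet> v / (norm v)\<^sup>2) *\<^sub>R v"
  shows "0 < d \<bullet> v" "(1 - \<sigma>\<^sup>2) * norm v \<le> 2 * norm a" "(1 - \<sigma>\<^sup>2) * norm d \<le> 2 * norm a"
proof -
  have s: "\<sigma>\<^sup>2 < 1" using \<sigma> by (simp add: power_less_one_iff)
  have "(norm (d - v))\<^sup>2 = (norm d)\<^sup>2 + (norm v)\<^sup>2 - 2 * (d \<bullet> v)"
    unfolding power2_norm_eq_inner by (simp add: algebra_simps inner_commute)
  with err have dv: "(1 - \<sigma>\<^sup>2) * ((norm d)\<^sup>2 + (norm v)\<^sup>2) \<le> 2 * (d \<bullet> v)"
    by (simp add: algebra_simps)
  have "0 < (1 - \<sigma>\<^sup>2) * ((norm d)\<^sup>2 + (norm v)\<^sup>2)"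
    using s v by (intro mult_pos_pos add_nonneg_pos) auto
  then show pos: "0 < d \<bullet> v" using dv by linarith
  then have na: "d \<bullet> v = norm a * norm v"
    using v unfolding a_def by (simp add: power2_eq_square)
  have bound: "(1 - \<sigma>\<^sup>2) * b \<le> 2 * norm a" if "b * norm v \<le> (norm d)\<^sup>2 + (norm v)\<^sup>2" for b
  proof -
    have "(1 - \<sigma>\<^sup>2) * (b * norm v) \<le> (1 - \<sigma>\<^sup>2) * ((norm d)\<^sup>2 + (norm v)\<^sup>2)"
      using that s by (intro mult_left_mono) auto
    then have "((1 - \<sigma>\<^sup>2) * b) * norm v \<le> (2 * norm a) * norm v"
      using dv na by (simp add: mult.assoc)
    then show ?thesis using v by simp
  qed
  show "(1 - \<sigma>\<^sup>2) * norm v \<le> 2 * norm a"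
    by (rule bound) (simp add: power2_eq_square)
  show "(1 - \<sigma>\<^sup>2) * norm d \<le> 2 * norm a"
  proof (rule bound)
    have "2 * norm d * norm v \<le> (norm d)\<^sup>2 + (norm v)\<^sup>2"
      by (rule sum_squares_bound)
    moreover have "0 \<le> norm d * norm v" by simp
    ultimately show "norm d * norm v \<le> (norm d)\<^sup>2 + (norm v)\<^sup>2" by linarith
  qed
qed

text \<open>The point \<open>w\<close> is the relaxed projection of \<open>h\<close> onto the hyperplane through \<open>h - d\<close> orthogonal to
  \<open>v\<close>; hypothesis \<open>sep\<close> says that \<open>s\<close> lies on the far side of it. For the relaxation \<open>\<rho>\<close> itself the
  decrease has the factor \<open>2 / \<rho> - 1\<close>, which is smallest at the upper bound \<open>r\<close>.\<close>

lemma relaxed_projection_decrease: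
  fixes h s d v :: "'a::real_inner"
  assumes v: "v \<noteq> 0" and sep: "d \<bullet> v \<le> (h - s) \<bullet> v" and dv: "0 < d \<bullet> v"
    and \<rho>: "0 < \<rho>" "\<rho> \<le> r"
  defines "w \<equiv> h - (\<rho> * (d \<bullet> v / (norm v)\<^sup>2)) *\<^sub>R v"
  shows "(norm (w - s))\<^sup>2 \<le> (norm (h - s))\<^sup>2 - (2 - r) / r * (norm (w - h))\<^sup>2"
proof -
  define t where "t = d \<bullet> v / (norm v)\<^sup>2"
  have t: "0 < t" "d \<bullet> v = t * (norm v)\<^sup>2"
    using dv v by (auto simp: t_def)
  have nwh: "(norm (w - h))\<^sup>2 = \<rho>\<^sup>2 * (t\<^sup>2 * (norm v)\<^sup>2)"
    by (simp add: w_def t_def[symmetric] power_mult_distrib)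
  have ws: "w - s = (h - s) - (\<rho> * t) *\<^sub>R v"
    by (simp add: w_def t_def)
  have "(norm (w - s))\<^sup>2 = (norm (h - s))\<^sup>2 - 2 * (\<rho> * t) * ((h - s) \<bullet> v) + (\<rho> * t)\<^sup>2 * (norm v)\<^sup>2"
    unfolding ws power2_norm_eq_inner
    by (simp add: inner_diff_left inner_diff_right inner_commute power2_eq_square algebra_simps)
  also have "\<dots> \<le> (norm (h - s))\<^sup>2 - 2 * (\<rho> * t) * (t * (norm v)\<^sup>2) + (\<rho> * t)\<^sup>2 * (norm v)\<^sup>2"
    using sep t \<rho> by (auto intro!: mult_left_mono)
  also have "\<dots> = (norm (h - s))\<^sup>2 - (2 / \<rho> - 1) * (norm (w - h))\<^sup>2"
    unfolding nwh using \<rho> by (simp add: field_simps power2_eq_square)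
  also have "\<dots> \<le> (norm (h - s))\<^sup>2 - (2 - r) / r * (norm (w - h))\<^sup>2"
  proof -
    have "(2 - r) / r \<le> 2 / \<rho> - 1"
      using \<rho> by (simp add: field_simps)
    then show ?thesis
      by (intro diff_left_mono mult_right_mono) auto
  qed
  finally show ?thesis .
qed

section \<open>Inertial iterations with a Fejer-type decrease\<close>

lemma norm_extrapolation:
  fixes u u' s :: "'a::real_inner"
  shows "(norm (u + a *\<^sub>R (u - u') - s))\<^sup>2
    = (1 + a) * (norm (u - s))\<^sup>2 - a * (norm (u' - s))\<^sup>2 + a * (1 + a) * (norm (u - u'))\<^sup>2"
  unfolding power2_norm_eq_inner
  by (simp add: inner_diff_left inner_diff_right inner_add_left inner_add_right inner_commute
      power2_eq_square algebra_simps)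

text \<open>The two sides differ by \<open>a \<parallel>(v - u) - (u - u')\<parallel>\<^sup>2\<close>.\<close>

lemma norm_step_from_extrapolation:
  fixes u u' v :: "'a::real_inner"
  assumes "0 \<le> a"
  shows "(1 - a) * (norm (v - u))\<^sup>2 - a * (1 - a) * (norm (u - u'))\<^sup>2
    \<le> (norm (v - (u + a *\<^sub>R (u - u'))))\<^sup>2"
proof -
  have "(norm (v - (u + a *\<^sub>R (u - u'))))\<^sup>2
    = (1 - a) * (norm (v - u))\<^sup>2 - a * (1 - a) * (norm (u - u'))\<^sup>2
      + a * (norm ((v - u) - (u - u')))\<^sup>2"
    unfolding power2_norm_eq_inner
    by (simp add: inner_diff_left inner_diff_right inner_add_left inner_add_right inner_commute
        power2_eq_square algebra_simps)
  then show ?thesis using assms by simp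
qed

text \<open>Past an index where the perturbation is below \<open>(1 - r) \<epsilon> / 2\<close>, the fixed point of the recursive
  bound is \<open>\<epsilon> / 2\<close>, and the excess over it decays like \<open>r ^ m\<close>.\<close>

lemma tendsto_zero_of_contraction_plus_null:
  fixes e :: "nat \<Rightarrow> real"
  assumes r: "0 \<le> r" "r < 1" and B: "\<And>n. \<bar>e n\<bar> \<le> B"
    and lim: "(\<lambda>n. e (Suc n) - r * e n) \<longlonglongrightarrow> 0"
  shows "e \<longlonglongrightarrow> 0"
proof (rule LIMSEQ_I)
  fix \<epsilon> :: real assume \<epsilon>: "0 < \<epsilon>"
  define \<delta> where "\<delta> = (1 - r) * \<epsilon> / 2"
  have "0 < \<delta>" using r \<epsilon> by (simp add: \<delta>_def)
  then obtain N where N: "\<And>n. N \<le> n \<Longrightarrow> \<bar>e (Suc n) - r * e n\<bar> < \<delta>"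
    using LIMSEQ_D[OF lim] by fastforce
  have geo: "\<bar>e (N + m)\<bar> \<le> r ^ m * B + \<epsilon> / 2" for m
  proof (induction m)
    case 0
    then show ?case using B[of N] \<epsilon> by simp
  next
    case (Suc m)
    have "\<bar>e (N + Suc m)\<bar> \<le> r * \<bar>e (N + m)\<bar> + \<delta>"
    proof -
      have "\<bar>r * e (N + m)\<bar> = r * \<bar>e (N + m)\<bar>" using r by (simp add: abs_mult)
      then show ?thesis using N[of "N + m"] by simp
    qed
    also have "\<dots> \<le> r * (r ^ m * B + \<epsilon> / 2) + \<delta>"
      using Suc r by (intro add_right_mono mult_left_mono) auto
    also have "\<dots> = r ^ Suc m * B + \<epsilon> / 2"
      by (simp add: \<delta>_def field_simps)
    finally show ?case .
  qed
  have "(\<lambda>m. r ^ m * B) \<longlonglongrightarrow> 0"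
    using LIMSEQ_realpow_zero[OF r] tendsto_mult_left_zero by blast
  then obtain M where M: "\<And>m. M \<le> m \<Longrightarrow> \<bar>r ^ m * B\<bar> < \<epsilon> / 2"
    using LIMSEQ_D[of _ 0 "\<epsilon> / 2"] \<epsilon> by fastforce
  have "norm (e n - 0) < \<epsilon>" if "N + M \<le> n" for n
  proof -
    have "\<bar>r ^ (n - N) * B\<bar> < \<epsilon> / 2" using M[of "n - N"] that by linarith
    moreover have "\<bar>e n\<bar> \<le> r ^ (n - N) * B + \<epsilon> / 2" using geo[of "n - N"] that by simp
    ultimately have "\<bar>e n\<bar> < \<epsilon>" by linarith
    then show ?thesis by simp
  qed
  then show "\<exists>no. \<forall>n\<ge>no. norm (e n - 0) < \<epsilon>" by blast
qed

text \<open>The proof uses the energy \<open>\<mu>\<close>: squared distance to \<open>s\<close>, minus its delayed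
  multiple, plus a weighted squared step. The weight \<open>\<gamma> (a k)\<close> is exactly the coefficient with which
  the old step \<open>\<delta> k\<close> enters the one-step estimate, so that \<open>\<delta> k\<close> cancels and the coefficient of
  \<open>\<delta> (Suc k)\<close> is at most \<open>A (1 + A) - \<eta> (1 - A)\<^sup>2 < 0\<close>. Hence \<open>\<mu>\<close> decreases, the distances stay bounded
  because \<open>A < 1\<close>, and \<open>\<mu>\<close> converges. This forces the steps to vanish and
  \<open>\<phi> k - a k \<phi> (k - 1)\<close> to converge; as the weights \<open>a k\<close> are monotone with a limit below 1, the
  recursion is asymptotically a contraction and \<open>\<phi>\<close> itself converges.\<close>

lemma inertial_Fejer_sequence:
  fixes w :: "nat \<Rightarrow> 'a::real_inner"
  assumes a0: "\<And>k. 0 \<le> a k" and aA: "\<And>k. a k \<le> A" and mono: "\<And>k. a k \<le> a (Suc k)"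
    and A: "A < 1" and \<eta>: "A * (1 + A) < \<eta> * (1 - A)\<^sup>2"
    and decrease: "\<And>k. (norm (w (Suc k) - s))\<^sup>2
      \<le> (norm (extrapolate a w k - s))\<^sup>2 - \<eta> * (norm (w (Suc k) - extrapolate a w k))\<^sup>2"
  shows "convergent (\<lambda>k. norm (w k - s))" "(\<lambda>k. w (Suc k) - w k) \<longlonglongrightarrow> 0"
proof -
  define \<phi> where "\<phi> k = (norm (w k - s))\<^sup>2" for k
  define \<delta> where "\<delta> k = (norm (w k - w (k - 1)))\<^sup>2" for k
  define \<gamma> where "\<gamma> t = t * (1 + t) + \<eta> * (t * (1 - t))" for t
  define \<mu> where "\<mu> k = \<phi> k - a k * \<phi> (k - 1) + \<gamma> (a k) * \<delta> k" for k
  define \<epsilon> where "\<epsilon> = \<eta> * (1 - A)\<^sup>2 - A * (1 + A)"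
  have \<epsilon>: "0 < \<epsilon>" using \<eta> by (simp add: \<epsilon>_def)
  have A0: "0 \<le> A" using a0[of 0] aA[of 0] by linarith
  have \<eta>0: "0 < \<eta>"
  proof -
    have "0 < \<eta> * (1 - A)\<^sup>2" using \<eta> A0 by (smt (verit) mult_nonneg_nonneg)
    then show ?thesis by (simp add: zero_less_mult_iff)
  qed
  have \<phi>0: "0 \<le> \<phi> k" and \<delta>0: "0 \<le> \<delta> k" for k
    by (simp_all add: \<phi>_def \<delta>_def)
  have \<gamma>0: "0 \<le> \<gamma> (a k)" for k
    using a0[of k] aA[of k] A \<eta>0 by (simp add: \<gamma>_def)
  have energy: "\<mu> (Suc k) \<le> \<mu> k - \<epsilon> * \<delta> (Suc k)" for k
  proof -
    let ?b = "a (Suc k)"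
    have "\<phi> (Suc k) \<le> (1 + a k) * \<phi> k - a k * \<phi> (k - 1) + a k * (1 + a k) * \<delta> k
        - \<eta> * ((1 - a k) * \<delta> (Suc k) - a k * (1 - a k) * \<delta> k)"
    proof -
      have "\<eta> * ((1 - a k) * \<delta> (Suc k) - a k * (1 - a k) * \<delta> k)
          \<le> \<eta> * (norm (w (Suc k) - extrapolate a w k))\<^sup>2"
        using norm_step_from_extrapolation[OF a0, of k "w (Suc k)" "w k" "w (k - 1)"] \<eta>0
        by (intro mult_left_mono) (auto simp: extrapolate_def \<delta>_def)
      then show ?thesis
        using decrease[of k] norm_extrapolation[of "w k" "a k" "w (k - 1)" s]
        unfolding extrapolate_def \<phi>_def \<delta>_def by linarith
    qed
    then have 1: "\<mu> (Suc k) - \<mu> k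
        \<le> - ((?b - a k) * \<phi> k) + (\<gamma> ?b - \<eta> * (1 - a k)) * \<delta> (Suc k)"
      by (simp add: \<mu>_def \<gamma>_def algebra_simps)
    have "\<gamma> ?b - \<eta> * (1 - a k) \<le> \<gamma> ?b - \<eta> * (1 - ?b)"
      using mono[of k] \<eta>0 by simp
    also have "\<dots> = ?b * (1 + ?b) - \<eta> * (1 - ?b)\<^sup>2"
      by (simp add: \<gamma>_def algebra_simps power2_eq_square)
    also have "\<dots> \<le> A * (1 + A) - \<eta> * (1 - A)\<^sup>2"
    proof -
      have "(1 - A)\<^sup>2 \<le> (1 - ?b)\<^sup>2"
        using aA[of "Suc k"] A by (intro power_mono) auto
      then show ?thesis
        using aA[of "Suc k"] a0[of "Suc k"] A0 \<eta>0 by (intro diff_mono mult_mono) auto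
    qed
    finally have "(\<gamma> ?b - \<eta> * (1 - a k)) * \<delta> (Suc k) \<le> - \<epsilon> * \<delta> (Suc k)"
      using \<delta>0 by (intro mult_right_mono) (auto simp: \<epsilon>_def)
    moreover have "0 \<le> (?b - a k) * \<phi> k"
      using mono[of k] \<phi>0 by simp
    ultimately show ?thesis using 1 by simp
  qed
  have "decseq \<mu>"
  proof (rule decseq_SucI)
    show "\<mu> (Suc k) \<le> \<mu> k" for k
      using energy[of k] mult_nonneg_nonneg[OF less_imp_le[OF \<epsilon>] \<delta>0[of "Suc k"]] by linarith
  qed
  then have \<mu>0: "\<mu> k \<le> \<mu> 0" for k
    by (simp add: decseq_def)
  define B where "B = max (\<phi> 0) (\<mu> 0 / (1 - A))"
  have rec: "\<phi> k - A * \<phi> (k - 1) \<le> \<mu> k" for k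
    using mult_nonneg_nonneg[OF \<gamma>0[of k] \<delta>0[of k]] mult_right_mono[OF aA[of k] \<phi>0[of "k - 1"]]
    unfolding \<mu>_def by linarith
  have B: "\<phi> k \<le> B" for k
  proof (induction k)
    case 0
    then show ?case by (simp add: B_def)
  next
    case (Suc k)
    have "\<phi> (Suc k) \<le> A * \<phi> k + \<mu> 0" using rec[of "Suc k"] \<mu>0[of "Suc k"] by simp
    also have "\<dots> \<le> A * B + (1 - A) * B"
    proof (intro add_mono mult_left_mono Suc A0)
      have "\<mu> 0 / (1 - A) \<le> B" by (simp add: B_def)
      then show "\<mu> 0 \<le> (1 - A) * B" using A by (simp add: field_simps)
    qed
    finally show ?case by (simp add: algebra_simps)
  qed
  have "- (A * B) \<le> \<mu> k" for k
    using rec[of k] \<phi>0[of k] mult_left_mono[OF B[of "k - 1"] A0] by linarith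
  with \<open>decseq \<mu>\<close> obtain m where m: "\<mu> \<longlonglongrightarrow> m"
    by (metis decseq_convergent)
  have \<delta>lim: "(\<lambda>k. \<delta> (Suc k)) \<longlonglongrightarrow> 0"
  proof (rule tendsto_sandwich[OF _ _ tendsto_const])
    show "(\<lambda>k. (\<mu> k - \<mu> (Suc k)) / \<epsilon>) \<longlonglongrightarrow> 0"
      using tendsto_divide[OF tendsto_diff[OF m LIMSEQ_Suc[OF m]] tendsto_const, of \<epsilon>] \<epsilon> by simp
    show "eventually (\<lambda>k. \<delta> (Suc k) \<le> (\<mu> k - \<mu> (Suc k)) / \<epsilon>) sequentially"
    proof (intro always_eventually allI)
      fix k show "\<delta> (Suc k) \<le> (\<mu> k - \<mu> (Suc k)) / \<epsilon>"
        using energy[of k] \<epsilon> by (simp add: field_simps)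
    qed
  qed (use \<delta>0 in auto)
  have "(\<lambda>k. sqrt (\<delta> (Suc k))) \<longlonglongrightarrow> sqrt 0"
    by (rule tendsto_real_sqrt[OF \<delta>lim])
  then show "(\<lambda>k. w (Suc k) - w k) \<longlonglongrightarrow> 0"
    by (simp add: \<delta>_def tendsto_norm_zero_iff)
  have "incseq a" using mono by (rule incseq_SucI)
  then obtain r where r: "a \<longlonglongrightarrow> r"
    using aA by (metis incseq_convergent)
  have r0: "0 \<le> r" and rA: "r \<le> A"
    using LIMSEQ_le_const[OF r] LIMSEQ_le_const2[OF r] a0 aA by blast+
  have r1: "r < 1" using rA A by linarith
  define L where "L = m / (1 - r)"
  have \<phi>lim: "(\<lambda>k. \<phi> k - L) \<longlonglongrightarrow> 0"
  proof (rule tendsto_zero_of_contraction_plus_null[OF r0 r1])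
    show "\<bar>\<phi> k - L\<bar> \<le> B + \<bar>L\<bar>" for k using B[of k] \<phi>0[of k] by linarith
    have a1: "(\<lambda>k. a (Suc k)) \<longlonglongrightarrow> r" by (rule LIMSEQ_Suc[OF r])
    have "(\<lambda>k. \<gamma> (a (Suc k))) \<longlonglongrightarrow> \<gamma> r"
      unfolding \<gamma>_def by (intro tendsto_intros a1)
    from tendsto_mult[OF this \<delta>lim]
    have g: "(\<lambda>k. \<gamma> (a (Suc k)) * \<delta> (Suc k)) \<longlonglongrightarrow> 0" by simp
    have h: "(\<lambda>k. (a (Suc k) - r) * \<phi> k) \<longlonglongrightarrow> 0"
    proof (rule Lim_null_comparison)
      show "eventually (\<lambda>k. norm ((a (Suc k) - r) * \<phi> k) \<le> \<bar>a (Suc k) - r\<bar> * B) sequentially"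
        using B \<phi>0 by (intro always_eventually) (auto simp: abs_mult intro!: mult_left_mono)
      have "(\<lambda>k. a (Suc k) - r) \<longlonglongrightarrow> 0" using a1 LIM_zero by blast
      then show "(\<lambda>k. \<bar>a (Suc k) - r\<bar> * B) \<longlonglongrightarrow> 0"
        by (intro tendsto_mult_left_zero tendsto_rabs_zero)
    qed
    have "(\<lambda>k. \<mu> (Suc k) - \<gamma> (a (Suc k)) * \<delta> (Suc k) + (a (Suc k) - r) * \<phi> k - m) \<longlonglongrightarrow> m - 0 + 0 - m"
      by (intro tendsto_intros g h LIMSEQ_Suc[OF m])
    moreover have "\<mu> (Suc k) - \<gamma> (a (Suc k)) * \<delta> (Suc k) + (a (Suc k) - r) * \<phi> k - m
        = \<phi> (Suc k) - L - r * (\<phi> k - L)" for k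
    proof -
      have "m = (1 - r) * L" using r1 by (simp add: L_def)
      then show ?thesis by (simp add: \<mu>_def algebra_simps)
    qed
    ultimately show "(\<lambda>k. \<phi> (Suc k) - L - r * (\<phi> k - L)) \<longlonglongrightarrow> 0" by simp
  qed
  have "\<phi> \<longlonglongrightarrow> L" using \<phi>lim LIM_zero_iff by blast
  then have "(\<lambda>k. sqrt (\<phi> k)) \<longlonglongrightarrow> sqrt L" by (rule tendsto_real_sqrt)
  then show "convergent (\<lambda>k. norm (w k - s))"
    by (auto simp: \<phi>_def convergent_def)
qed

section \<open>Runs of the algorithm\<close>

text \<open>Add the monotonicity inequality of \<open>\<partial>f\<close> between \<open>x\<close> and \<open>xs\<close> to that of \<open>\<partial>g\<close> between \<open>z\<close> and \<open>xs\<close>;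
  the pairings with \<open>xs\<close> combine into a single inner product with \<open>x - z\<close>.\<close>

lemma KT_separation:
  assumes "proper_fun f" "proper_fun g"
    and "- p \<in> subdiff f x" "p + c *\<^sub>R (x - z) \<in> subdiff g z"
    and "ps \<in> subdiff g xs" "- ps \<in> subdiff f xs"
  shows "((c *\<^sub>R xs - ps) - (c *\<^sub>R z - p)) \<bullet> (x - z) \<le> 0"
proof -
  have "0 \<le> (- p - - ps) \<bullet> (x - xs)" "0 \<le> (p + c *\<^sub>R (x - z) - ps) \<bullet> (z - xs)"
    using subdiff_monotone assms by metis+
  moreover have "((c *\<^sub>R xs - ps) - (c *\<^sub>R z - p)) \<bullet> (x - z)
    = - ((- p - - ps) \<bullet> (x - xs)) - (p + c *\<^sub>R (x - z) - ps) \<bullet> (z - xs)"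
    by (simp add: inner_diff_left inner_diff_right inner_add_left inner_add_right inner_commute
        algebra_simps)
  ultimately show ?thesis by linarith
qed

lemma inner_step_KT:
  assumes f: "proper_fun f" "convex_fun f" and g: "proper_fun g" "convex_fun g"
    and F: "F_procedure f F" and c: "0 < c" and l: "1 \<le> l" and step: "inner_step g F c R k l"
  shows "- pin R k l \<in> subdiff f (xin R k l)"
    and "pin R k l + c *\<^sub>R (xin R k l - zin R k l) \<in> subdiff g (zin R k l)"
    and "c *\<^sub>R xin R k l - pin R k l = (c *\<^sub>R zhat R k - phat R k) + yin R k l"
proof -
  have xy: "xin R k l = fst (F (phat R k) (zhat R k) c (xhat R k) l)"
      "yin R k l = snd (F (phat R k) (zhat R k) c (xhat R k) l)"
    and p: "pin R k l = phat R k + c *\<^sub>R (xin R k l - zhat R k) - yin R k l"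
    using step unfolding inner_step_def by (metis fst_conv, metis snd_conv, blast)
  have "yin R k l \<in> subdiff (\<lambda>x. f x + ereal (phat R k \<bullet> x + c / 2 * (norm (x - zhat R k))\<^sup>2))
      (xin R k l)"
    using F c l unfolding F_procedure_def xy by blast
  from subdiff_quadratic_perturbation[OF f this]
  show "- pin R k l \<in> subdiff f (xin R k l)"
    by (simp add: p algebra_simps)
  show "pin R k l + c *\<^sub>R (xin R k l - zin R k l) \<in> subdiff g (zin R k l)"
    using step unfolding inner_step_def by (blast intro: subdiff_of_proximal_argmin[OF g])
  show "c *\<^sub>R xin R k l - pin R k l = (c *\<^sub>R zhat R k - phat R k) + yin R k l"
    by (simp add: p algebra_simps)
qed

text \<open>The expression \<open>p - phat - c (z - zhat)\<close> in the test is \<open>d\<close>, the offset from \<open>c z - p\<close> to the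
  extrapolated point.\<close>

lemma inner_test_residuals:
  assumes y: "c *\<^sub>R xin R k l - pin R k l = (c *\<^sub>R zhat R k - phat R k) + yin R k l"
  defines "d \<equiv> (c *\<^sub>R zhat R k - phat R k) - (c *\<^sub>R zin R k l - pin R k l)"
    and "v \<equiv> c *\<^sub>R (xin R k l - zin R k l)"
  shows "d - v = - yin R k l"
    and "inner_test c \<sigma> R k l \<longleftrightarrow> (norm (d - v))\<^sup>2 \<le> \<sigma>\<^sup>2 * ((norm d)\<^sup>2 + (norm v)\<^sup>2)"
proof -
  show dv: "d - v = - yin R k l"
    using y unfolding d_def v_def by (simp add: algebra_simps)
  have "pin R k l - phat R k - c *\<^sub>R (zin R k l - zhat R k) = d"
    by (simp add: d_def algebra_simps)
  then show "inner_test c \<sigma> R k l \<longleftrightarrow> (norm (d - v))\<^sup>2 \<le> \<sigma>\<^sup>2 * ((norm d)\<^sup>2 + (norm v)\<^sup>2)"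
    unfolding inner_test_def dv by (simp add: v_def power_mult_distrib)
qed

text \<open>With \<open>d = 0\<close> the test reads \<open>\<parallel>v\<parallel>\<^sup>2 \<le> \<sigma>\<^sup>2 \<parallel>v\<parallel>\<^sup>2\<close>, so \<open>v = 0\<close> because \<open>\<sigma> < 1\<close>.\<close>

lemma inner_test_residual_zero:
  assumes y: "c *\<^sub>R xin R k l - pin R k l = (c *\<^sub>R zhat R k - phat R k) + yin R k l"
    and test: "inner_test c \<sigma> R k l" and \<sigma>: "0 \<le> \<sigma>" "\<sigma> < 1" and c: "0 < c"
    and eq: "pin R k l - phat R k = c *\<^sub>R (zin R k l - zhat R k)"
  shows "xin R k l = zin R k l"
proof -
  define v where "v = c *\<^sub>R (xin R k l - zin R k l)"
  have "(c *\<^sub>R zhat R k - phat R k) - (c *\<^sub>R zin R k l - pin R k l) = 0"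
    using eq by (simp add: algebra_simps)
  then have "(norm v)\<^sup>2 \<le> \<sigma>\<^sup>2 * (norm v)\<^sup>2"
    using test unfolding inner_test_residuals(2)[OF y] v_def by simp
  moreover have "\<sigma>\<^sup>2 < 1" using \<sigma> by (simp add: power_less_one_iff)
  ultimately have "(norm v)\<^sup>2 = 0"
    by (smt (verit) mult_less_cancel_right2 zero_le_power2)
  then show ?thesis using c by (simp add: v_def)
qed

text \<open>The scalar \<open>\<theta>\<close> is \<open>\<langle>d, v\<rangle> / \<parallel>v\<parallel>\<^sup>2\<close>, hence the update of \<open>c z - p\<close> is a relaxed projection of \<open>h\<close>, of
  length \<open>\<rho>\<^sub>k \<parallel>a\<parallel>\<close> with \<open>a\<close> the full projection step. The last two conclusions bound both the gap
  \<open>x - z\<close> and the error \<open>y\<close> by that length, so they vanish along with the steps.\<close>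

lemma outer_step:
  assumes c: "0 < c" and \<sigma>: "0 \<le> \<sigma>" "\<sigma> < 1" and \<rho>: "0 < \<rho>lo"
    and y: "c *\<^sub>R xin R k l - pin R k l = (c *\<^sub>R zhat R k - phat R k) + yin R k l"
    and test: "inner_test c \<sigma> R k l" and ne: "xin R k l \<noteq> zin R k l"
    and upd: "outer_update c \<rho>lo \<rho>hi R k l"
  defines "h \<equiv> c *\<^sub>R zhat R k - phat R k" and "w \<equiv> c *\<^sub>R Z R (Suc k) - P R (Suc k)"
  shows "(s - (c *\<^sub>R zin R k l - pin R k l)) \<bullet> (xin R k l - zin R k l) \<le> 0 \<Longrightarrow>
      (norm (w - s))\<^sup>2 \<le> (norm (h - s))\<^sup>2 - (2 - \<rho>hi) / \<rho>hi * (norm (w - h))\<^sup>2"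
    and "\<rho>lo * (1 - \<sigma>\<^sup>2) * norm (c *\<^sub>R (xin R k l - zin R k l)) \<le> 2 * norm (w - h)"
    and "\<rho>lo * (1 - \<sigma>\<^sup>2) * norm (yin R k l) \<le> 4 * norm (w - h)"
proof -
  define d where "d = h - (c *\<^sub>R zin R k l - pin R k l)"
  define v where "v = c *\<^sub>R (xin R k l - zin R k l)"
  define a where "a = (d \<bullet> v / (norm v)\<^sup>2) *\<^sub>R v"
  define \<rho>' where "\<rho>' = rhos R k"
  have \<rho>': "\<rho>lo \<le> \<rho>'" "\<rho>' \<le> \<rho>hi"
    using upd unfolding outer_update_def \<rho>'_def by auto
  have v: "v \<noteq> 0" using ne c by (simp add: v_def)
  have dv: "d - v = - yin R k l"
    using inner_test_residuals(1)[OF y] unfolding d_def v_def h_def .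
  have "(norm (d - v))\<^sup>2 \<le> \<sigma>\<^sup>2 * ((norm d)\<^sup>2 + (norm v)\<^sup>2)"
    using test unfolding inner_test_residuals(2)[OF y] d_def v_def h_def .
  note err = relative_error_controls_projection[OF this \<sigma> v, folded a_def]
  have th: "theta c R k l = d \<bullet> v / (norm v)\<^sup>2"
  proof -
    have "c *\<^sub>R (zhat R k - zin R k l) - (phat R k - pin R k l) = d"
      by (simp add: d_def h_def algebra_simps)
    then show ?thesis
      using c by (simp add: theta_def v_def power_mult_distrib power2_eq_square)
  qed
  have "w = h - (\<rho>' * theta c R k l) *\<^sub>R v"
    using upd unfolding outer_update_def w_def h_def v_def \<rho>'_def
    by (elim conjE) (simp add: algebra_simps)
  then have w: "w = h - (\<rho>' * (d \<bullet> v / (norm v)\<^sup>2)) *\<^sub>R v"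
    by (simp only: th)
  show "(norm (w - s))\<^sup>2 \<le> (norm (h - s))\<^sup>2 - (2 - \<rho>hi) / \<rho>hi * (norm (w - h))\<^sup>2"
    if "(s - (c *\<^sub>R zin R k l - pin R k l)) \<bullet> (xin R k l - zin R k l) \<le> 0"
  proof -
    have "c * ((s - (c *\<^sub>R zin R k l - pin R k l)) \<bullet> (xin R k l - zin R k l)) \<le> 0"
      using that c by (simp add: mult_nonneg_nonpos)
    moreover have "d \<bullet> v - (h - s) \<bullet> v
        = c * ((s - (c *\<^sub>R zin R k l - pin R k l)) \<bullet> (xin R k l - zin R k l))"
      by (simp add: d_def v_def inner_diff_left inner_diff_right algebra_simps)
    ultimately have "d \<bullet> v \<le> (h - s) \<bullet> v" by linarith
    from relaxed_projection_decrease[OF v this err(1)] show ?thesis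
      using \<rho> \<rho>' unfolding w by simp
  qed
  have "norm (w - h) = \<rho>' * norm a"
    using \<rho> \<rho>' by (simp add: w a_def abs_mult)
  then have na: "\<rho>lo * norm a \<le> norm (w - h)"
    using \<rho>' by (simp add: mult_right_mono)
  have bound: "\<rho>lo * (1 - \<sigma>\<^sup>2) * b \<le> 2 * norm (w - h)" if "(1 - \<sigma>\<^sup>2) * b \<le> 2 * norm a" for b
    using mult_left_mono[OF that less_imp_le[OF \<rho>]] na by (simp add: mult.assoc)
  show "\<rho>lo * (1 - \<sigma>\<^sup>2) * norm (c *\<^sub>R (xin R k l - zin R k l)) \<le> 2 * norm (w - h)"
    using bound[OF err(2)] by (simp only: v_def)
  have "norm (yin R k l) \<le> norm d + norm v"
    using norm_triangle_ineq4[of d v] unfolding dv by simp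
  moreover have "0 \<le> \<rho>lo * (1 - \<sigma>\<^sup>2)"
    using \<rho> \<sigma> by (simp add: power_le_one)
  ultimately have "\<rho>lo * (1 - \<sigma>\<^sup>2) * norm (yin R k l) \<le> \<rho>lo * (1 - \<sigma>\<^sup>2) * (norm d + norm v)"
    by (rule mult_left_mono)
  then show "\<rho>lo * (1 - \<sigma>\<^sup>2) * norm (yin R k l) \<le> 4 * norm (w - h)"
    using bound[OF err(2)] bound[OF err(3)] by (simp add: distrib_left)
qed

text \<open>A failed test bounds \<open>\<sigma> c \<parallel>x - z\<parallel>\<close> by \<open>\<parallel>y\<parallel>\<close>, which tends to zero. This needs \<open>\<sigma> > 0\<close>: for \<open>\<sigma> = 0\<close> a
  failed test only says \<open>y \<noteq> 0\<close>. The inner sequences are shifted by one because the loop is numbered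
  from 1.\<close>

lemma nonterminating_inner_loop_converges:
  fixes f g :: "'a::{real_inner, complete_space} \<Rightarrow> ereal"
  assumes f: "proper_fun f" "convex_fun f" "lsc_fun f" and g: "proper_fun g" "convex_fun g" "lsc_fun g"
    and F: "F_procedure f F" and c: "0 < c" and \<sigma>: "0 < \<sigma>"
    and step: "\<And>l. 1 \<le> l \<Longrightarrow> inner_step g F c R k l"
    and test: "\<And>l. 1 \<le> l \<Longrightarrow> \<not> inner_test c \<sigma> R k l"
  obtains xs ps where "xin R k \<longlonglongrightarrow> xs" "zin R k \<longlonglongrightarrow> xs" "pin R k \<longlonglongrightarrow> ps"
    "ps \<in> subdiff g xs" "- ps \<in> subdiff f xs"
proof -
  define h where "h = c *\<^sub>R zhat R k - phat R k"
  note KT = inner_step_KT[OF f(1,2) g(1,2) F c _ step]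
  have "(\<lambda>l. snd (F (phat R k) (zhat R k) c (xhat R k) l)) \<longlonglongrightarrow> 0"
    using F c unfolding F_procedure_def by blast
  moreover have "yin R k (Suc l) = snd (F (phat R k) (zhat R k) c (xhat R k) (Suc l))" for l
    using step[of "Suc l"] unfolding inner_step_def by (metis le_add1 plus_1_eq_Suc snd_conv)
  ultimately have y: "(\<lambda>l. yin R k (Suc l)) \<longlonglongrightarrow> 0"
    using LIMSEQ_Suc by fastforce
  have small: "\<sigma> * c * norm (xin R k (Suc l) - zin R k (Suc l)) \<le> norm (yin R k (Suc l))" for l
  proof -
    let ?d = "(c *\<^sub>R zhat R k - phat R k) - (c *\<^sub>R zin R k (Suc l) - pin R k (Suc l))"
    let ?v = "c *\<^sub>R (xin R k (Suc l) - zin R k (Suc l))"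
    have yd: "c *\<^sub>R xin R k (Suc l) - pin R k (Suc l) = (c *\<^sub>R zhat R k - phat R k) + yin R k (Suc l)"
      by (rule KT(3)) auto
    have "\<sigma>\<^sup>2 * ((norm ?d)\<^sup>2 + (norm ?v)\<^sup>2) < (norm (yin R k (Suc l)))\<^sup>2"
      using test[of "Suc l"] unfolding inner_test_residuals[OF yd] by simp
    moreover have "(\<sigma> * norm ?v)\<^sup>2 \<le> \<sigma>\<^sup>2 * ((norm ?d)\<^sup>2 + (norm ?v)\<^sup>2)"
      by (simp add: power_mult_distrib distrib_left)
    ultimately have "(\<sigma> * norm ?v)\<^sup>2 \<le> (norm (yin R k (Suc l)))\<^sup>2" by linarith
    then have "\<sigma> * norm ?v \<le> norm (yin R k (Suc l))"
      by (rule power2_le_imp_le) simp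
    then show ?thesis using c by (simp add: mult.assoc)
  qed
  have xz: "(\<lambda>l. xin R k (Suc l) - zin R k (Suc l)) \<longlonglongrightarrow> 0"
  proof (rule Lim_null_comparison)
    show "eventually (\<lambda>l. norm (xin R k (Suc l) - zin R k (Suc l))
        \<le> norm (yin R k (Suc l)) / (\<sigma> * c)) sequentially"
      using small \<sigma> c by (intro always_eventually) (auto simp: field_simps)
    show "(\<lambda>l. norm (yin R k (Suc l)) / (\<sigma> * c)) \<longlonglongrightarrow> 0"
      using tendsto_divide[OF tendsto_norm[OF y] tendsto_const, of "\<sigma> * c"] \<sigma> c by simp
  qed
  have "(\<lambda>l. c *\<^sub>R xin R k (Suc l) - pin R k (Suc l)) \<longlonglongrightarrow> h"
    using tendsto_add[OF tendsto_const[of h] y] KT(3) unfolding h_def by simp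
  note u = this
  have KT': "- pin R k (Suc l) \<in> subdiff f (xin R k (Suc l))"
      "pin R k (Suc l) + c *\<^sub>R (xin R k (Suc l) - zin R k (Suc l)) \<in> subdiff g (zin R k (Suc l))" for l
    by (rule KT; simp)+
  obtain xs ps where "(\<lambda>l. xin R k (Suc l)) \<longlonglongrightarrow> xs" "(\<lambda>l. zin R k (Suc l)) \<longlonglongrightarrow> xs"
      "(\<lambda>l. pin R k (Suc l)) \<longlonglongrightarrow> ps" and ps: "ps \<in> subdiff g xs" "- ps \<in> subdiff f xs"
      and "h = c *\<^sub>R xs - ps"
    by (rule approximate_KT_pairs_converge[where x = "\<lambda>l. xin R k (Suc l)" and z = "\<lambda>l. zin R k (Suc l)"
          and p = "\<lambda>l. pin R k (Suc l)", OF f(1,3) g(3) c KT' xz u])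
  then show thesis
    by (intro that[OF _ _ _ ps]) (erule LIMSEQ_imp_Suc)+
qed

text \<open>The formula for \<open>\<rho>\<close> makes \<open>(2 - \<rho>) / \<rho> = \<beta> (1 + \<beta>) / (1 - \<beta>)\<^sup>2\<close>. The claim thus compares the value of
  the increasing function \<open>t (1 + t) / (1 - t)\<^sup>2\<close> at \<open>\<alpha>\<close> and at \<open>\<beta>\<close>.\<close>

lemma inertial_parameter_bound:
  fixes \<alpha> \<beta> \<rho> :: real
  assumes "0 \<le> \<alpha>" "\<alpha> < \<beta>" "\<beta> < 1"
    and rho: "\<rho> = 2 * (\<beta> - 1)\<^sup>2 / (2 * (\<beta> - 1)\<^sup>2 + 3 * \<beta> - 1)"
  shows "\<alpha> * (1 + \<alpha>) < (2 - \<rho>) / \<rho> * (1 - \<alpha>)\<^sup>2"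
proof -
  define E where "E = 2 * (\<beta> - 1)\<^sup>2 + 3 * \<beta> - 1"
  have "E = (\<beta> - 1)\<^sup>2 + \<beta> * (\<beta> + 1)"
    by (simp add: E_def power2_eq_square algebra_simps)
  then have E: "0 < E" "2 * E - 2 * (\<beta> - 1)\<^sup>2 = 2 * (\<beta> * (\<beta> + 1))"
    using assms by (auto intro: add_nonneg_pos)
  have b: "\<beta> - 1 \<noteq> 0" using assms by simp
  have "(2 - \<rho>) / \<rho> = (2 * E - 2 * (\<beta> - 1)\<^sup>2) / (2 * (\<beta> - 1)\<^sup>2)"
    using E b unfolding rho E_def[symmetric] by (simp add: field_simps)
  then have \<eta>: "(2 - \<rho>) / \<rho> = \<beta> * (\<beta> + 1) / (1 - \<beta>)\<^sup>2"
    unfolding E(2) by (simp add: power2_commute)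
  have "(\<alpha> * (1 - \<beta>)) * ((1 + \<alpha>) * (1 - \<beta>)) < (\<beta> * (1 - \<alpha>)) * ((1 + \<beta>) * (1 - \<alpha>))"
    using assms mult_right_mono[of \<beta> 1 "1 + \<alpha>"]
    by (intro mult_strict_mono) (auto simp: algebra_simps)
  then have "\<alpha> * (1 + \<alpha>) * (1 - \<beta>)\<^sup>2 < \<beta> * (\<beta> + 1) * (1 - \<alpha>)\<^sup>2"
    by (simp add: power2_eq_square algebra_simps)
  then show ?thesis
    using assms unfolding \<eta> by (simp add: field_simps)
qed

text \<open>The function \<open>l\<close> gives the terminating index of each inner loop. The finite dimension is used to
  extract a convergent subsequence of the bounded sequence \<open>c z - p\<close>.\<close>

lemma infinite_outer_loop_converges:
  fixes f g :: "'a::euclidean_space \<Rightarrow> ereal"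
  assumes f: "proper_fun f" "convex_fun f" "lsc_fun f" and g: "proper_fun g" "convex_fun g" "lsc_fun g"
    and KT0: "ps0 \<in> subdiff g xs0" "- ps0 \<in> subdiff f xs0"
    and F: "F_procedure f F" and c: "0 < c" and \<sigma>: "0 \<le> \<sigma>" "\<sigma> < 1" and \<rho>: "0 < \<rho>lo"
    and a: "\<And>k. alphas R k \<in> {0..A}" "\<And>k. alphas R k \<le> alphas R (Suc k)"
    and A: "A < 1" "A * (1 + A) < (2 - \<rho>hi) / \<rho>hi * (1 - A)\<^sup>2"
    and l: "\<And>k. 1 \<le> l k"
    and step: "\<And>k. inner_step g F c R k (l k)" and test: "\<And>k. inner_test c \<sigma> R k (l k)"
    and ne: "\<And>k. xin R k (l k) \<noteq> zin R k (l k)"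
    and upd: "\<And>k. outer_update c \<rho>lo \<rho>hi R k (l k)"
  obtains xs ps where "X R \<longlonglongrightarrow> xs" "Z R \<longlonglongrightarrow> xs" "P R \<longlonglongrightarrow> ps"
    "ps \<in> subdiff g xs" "- ps \<in> subdiff f xs"
proof -
  define w where "w k = c *\<^sub>R Z R k - P R k" for k
  define h where "h k = c *\<^sub>R zhat R k - phat R k" for k
  have h: "h k = extrapolate (alphas R) w k" for k
    by (simp add: h_def w_def zhat_def phat_def extrapolate_def algebra_simps)
  note KT = inner_step_KT[OF f(1,2) g(1,2) F c l step]
  note outer = outer_step[OF c \<sigma> \<rho> KT(3) test ne upd, folded h_def w_def]
  have fejer: "convergent (\<lambda>k. norm (w k - (c *\<^sub>R xs - ps)))" "(\<lambda>k. w (Suc k) - w k) \<longlonglongrightarrow> 0"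
    if "ps \<in> subdiff g xs" "- ps \<in> subdiff f xs" for xs ps
  proof -
    have "(norm (w (Suc k) - (c *\<^sub>R xs - ps)))\<^sup>2 \<le> (norm (h k - (c *\<^sub>R xs - ps)))\<^sup>2
        - (2 - \<rho>hi) / \<rho>hi * (norm (w (Suc k) - h k))\<^sup>2" for k
      using outer(1) KT_separation[OF f(1) g(1) KT(1,2) that] .
    note dec = this[unfolded h]
    have a': "\<And>k. 0 \<le> alphas R k" "\<And>k. alphas R k \<le> A" using a(1) by auto
    show "convergent (\<lambda>k. norm (w k - (c *\<^sub>R xs - ps)))" "(\<lambda>k. w (Suc k) - w k) \<longlonglongrightarrow> 0"
      using inertial_Fejer_sequence[OF a' a(2) A dec] by blast+
  qed
  \<comment> \<open>Writing the last step as \<open>w (Suc (k - 1)) - w (k - 1)\<close> makes it a shift of the null sequence of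
    steps; at \<open>k = 0\<close> the extrapolation term is zero since \<open>k - 1 = 0\<close>.\<close>
  have hw: "(\<lambda>k. h k - w k) \<longlonglongrightarrow> 0"
  proof -
    have "(\<lambda>k. w (Suc (k - 1)) - w (k - 1)) \<longlonglongrightarrow> 0"
      by (rule LIMSEQ_imp_Suc) (simp add: fejer(2)[OF KT0])
    then have nz: "(\<lambda>k. norm (w (Suc (k - 1)) - w (k - 1))) \<longlonglongrightarrow> 0"
      by (rule tendsto_norm_zero)
    show ?thesis
    proof (rule Lim_null_comparison[OF always_eventually nz], rule allI)
      fix k
      have "norm (h k - w k) = alphas R k * norm (w k - w (k - 1))"
        using a(1)[of k] by (simp add: h extrapolate_def)
      also have "\<dots> \<le> 1 * norm (w k - w (k - 1))"
        using a(1)[of k] A(1) by (intro mult_right_mono) auto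
      also have "\<dots> \<le> norm (w (Suc (k - 1)) - w (k - 1))"
        by (cases k) auto
      finally show "norm (h k - w k) \<le> norm (w (Suc (k - 1)) - w (k - 1))" .
    qed
  qed
  have wh: "(\<lambda>k. norm (w (Suc k) - h k)) \<longlonglongrightarrow> 0"
  proof (rule tendsto_norm_zero)
    show "(\<lambda>k. w (Suc k) - h k) \<longlonglongrightarrow> 0"
      using tendsto_diff[OF fejer(2)[OF KT0] hw] by simp
  qed
  define \<kappa> where "\<kappa> = \<rho>lo * (1 - \<sigma>\<^sup>2)"
  have \<kappa>: "0 < \<kappa>" using \<rho> \<sigma> by (simp add: \<kappa>_def power_less_one_iff)
  have null: "b \<longlonglongrightarrow> 0" if "\<And>k. C * norm (b k) \<le> D * norm (w (Suc k) - h k)" "0 < C"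
    for b :: "nat \<Rightarrow> 'a" and C D
  proof (rule Lim_null_comparison)
    show "eventually (\<lambda>k. norm (b k) \<le> D / C * norm (w (Suc k) - h k)) sequentially"
      using that by (intro always_eventually) (auto simp: field_simps)
    show "(\<lambda>k. D / C * norm (w (Suc k) - h k)) \<longlonglongrightarrow> 0"
      by (rule tendsto_mult_right_zero[OF wh])
  qed
  have y: "(\<lambda>k. yin R k (l k)) \<longlonglongrightarrow> 0"
    by (rule null[OF outer(3)[folded \<kappa>_def] \<kappa>])
  have xz: "(\<lambda>k. xin R k (l k) - zin R k (l k)) \<longlonglongrightarrow> 0"
  proof (rule null)
    show "(\<kappa> * c) * norm (xin R k (l k) - zin R k (l k)) \<le> 2 * norm (w (Suc k) - h k)" for k
      using outer(2)[of k, folded \<kappa>_def] c by (simp add: mult.assoc)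
    show "0 < \<kappa> * c" using \<kappa> c by simp
  qed
  have u: "(\<lambda>k. (c *\<^sub>R xin R k (l k) - pin R k (l k)) - w k) \<longlonglongrightarrow> 0"
    using tendsto_add[OF hw y] unfolding KT(3) h_def by (simp add: algebra_simps)
  have KT_limit: "\<exists>xs ps. (\<lambda>n. xin R (r n) (l (r n))) \<longlonglongrightarrow> xs \<and> (\<lambda>n. zin R (r n) (l (r n))) \<longlonglongrightarrow> xs \<and>
      ps \<in> subdiff g xs \<and> - ps \<in> subdiff f xs \<and> s = c *\<^sub>R xs - ps"
    if r: "strict_mono r" and s: "(\<lambda>n. w (r n)) \<longlonglongrightarrow> s" for r s
  proof -
    have "(\<lambda>n. c *\<^sub>R xin R (r n) (l (r n)) - pin R (r n) (l (r n))) \<longlonglongrightarrow> s"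
      using tendsto_add[OF LIMSEQ_subseq_LIMSEQ[OF u r] s] by (simp add: o_def)
    then obtain xs ps where "(\<lambda>n. xin R (r n) (l (r n))) \<longlonglongrightarrow> xs" "(\<lambda>n. zin R (r n) (l (r n))) \<longlonglongrightarrow> xs"
        "(\<lambda>n. pin R (r n) (l (r n))) \<longlonglongrightarrow> ps"
        "ps \<in> subdiff g xs" "- ps \<in> subdiff f xs" "s = c *\<^sub>R xs - ps"
      by (rule approximate_KT_pairs_converge[where x = "\<lambda>n. xin R (r n) (l (r n))"
            and z = "\<lambda>n. zin R (r n) (l (r n))" and p = "\<lambda>n. pin R (r n) (l (r n))",
            OF f(1,3) g(3) c KT(1) KT(2) LIMSEQ_subseq_LIMSEQ[OF xz r, unfolded o_def]])
    then show ?thesis by blast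
  qed
  obtain B where B: "\<And>k. norm (w k - (c *\<^sub>R xs0 - ps0)) \<le> B"
    using convergent_imp_Bseq[OF fejer(1)[OF KT0]] unfolding Bseq_def by auto
  have "norm (w k) \<le> B + norm (c *\<^sub>R xs0 - ps0)" for k
    using B[of k] norm_triangle_sub[of "w k" "c *\<^sub>R xs0 - ps0"] by linarith
  then have "bounded (range w)" unfolding bounded_iff by blast
  then obtain s r where r: "strict_mono r" and s: "(\<lambda>n. w (r n)) \<longlonglongrightarrow> s"
    using bounded_imp_convergent_subsequence unfolding o_def by blast
  obtain xs ps where ps: "ps \<in> subdiff g xs" "- ps \<in> subdiff f xs" and seq: "s = c *\<^sub>R xs - ps"
    using KT_limit[OF r s] by blast
  obtain L where L: "(\<lambda>k. norm (w k - s)) \<longlonglongrightarrow> L"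
    using fejer(1)[OF ps] unfolding seq convergent_def by blast
  have "(\<lambda>n. norm (w (r n) - s)) \<longlonglongrightarrow> 0"
    using s by (simp add: LIM_zero tendsto_norm_zero)
  then have "L = 0"
    by (rule LIMSEQ_unique[OF LIMSEQ_subseq_LIMSEQ[OF L r, unfolded o_def]])
  with L have w: "w \<longlonglongrightarrow> s"
    by (auto intro: LIM_zero_cancel tendsto_norm_zero_cancel)
  \<comment> \<open>Now that all of \<open>w\<close> converges, the identity subsequence gives the limits of the iterates.\<close>
  obtain xs' ps' where x: "(\<lambda>k. xin R k (l k)) \<longlonglongrightarrow> xs'" and z: "(\<lambda>k. zin R k (l k)) \<longlonglongrightarrow> xs'"
    and ps': "ps' \<in> subdiff g xs'" "- ps' \<in> subdiff f xs'" and seq': "s = c *\<^sub>R xs' - ps'"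
    using KT_limit[of "\<lambda>n. n" s] w by (auto simp: strict_mono_def)
  have X: "X R \<longlonglongrightarrow> xs'" and Z: "Z R \<longlonglongrightarrow> xs'"
    using x z upd unfolding outer_update_def by (simp_all add: LIMSEQ_imp_Suc)
  \<comment> \<open>The multiplier \<open>P\<close> differs from \<open>pin\<close> through the relaxation, so its limit is read off from
    \<open>w\<close> and \<open>Z\<close>.\<close>
  have "(\<lambda>k. c *\<^sub>R Z R k - w k) \<longlonglongrightarrow> c *\<^sub>R xs' - s"
    by (intro tendsto_intros Z w)
  then have "P R \<longlonglongrightarrow> ps'" by (simp add: w_def seq')
  from that[OF X Z this ps'] show thesis .
qed

theorem theorem4p4:
  fixes f g :: "real ^ 'n \<Rightarrow> ereal"
    and F :: "real ^ 'n \<Rightarrow> real ^ 'n \<Rightarrow> real \<Rightarrow> real ^ 'n \<Rightarrow> nat \<Rightarrow> (real ^ 'n) \<times> (real ^ 'n)"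
    and c \<alpha> \<beta> \<sigma> \<rho>lo \<rho>hi :: real
    and R :: "(real ^ 'n) run"
  assumes f: "proper_fun f" "convex_fun f" "lsc_fun f"
    and g: "proper_fun g" "convex_fun g" "lsc_fun g"
    and solvable: "\<exists>x. 0 \<in> subdiff f x + subdiff g x"
    and F: "F_procedure f F"
    and run: "admm_run g F c \<alpha> \<sigma> \<rho>lo \<rho>hi R"
    and beta: "0 < \<beta>" "\<alpha> < \<beta>" "\<beta> < 1"
    and alphas_mono: "\<And>k. enat (Suc k) < outer_len R \<Longrightarrow> alphas R k \<le> alphas R (Suc k)"
    and rho: "\<rho>hi = 2 * (\<beta> - 1)\<^sup>2 / (2 * (\<beta> - 1)\<^sup>2 + 3 * \<beta> - 1)"
  shows
    "(outer_len R = \<infinity> \<and> (\<forall>k. inner_len R k \<noteq> \<infinity>) \<longrightarrow>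
        (\<exists>xs ps. X R \<longlonglongrightarrow> xs \<and> Z R \<longlonglongrightarrow> xs \<and> 0 \<in> subdiff f xs + subdiff g xs \<and>
           P R \<longlonglongrightarrow> ps \<and> ps \<in> subdiff g xs \<and> - ps \<in> subdiff f xs))
     \<and> (\<forall>kbar. 0 < \<sigma> \<and> outer_len R = enat (Suc kbar) \<and> inner_len R kbar = \<infinity> \<longrightarrow>
        (\<exists>xs ps. xin R kbar \<longlonglongrightarrow> xs \<and> zin R kbar \<longlonglongrightarrow> xs \<and> 0 \<in> subdiff f xs + subdiff g xs \<and>
           pin R kbar \<longlonglongrightarrow> ps \<and> ps \<in> subdiff g xs \<and> - ps \<in> subdiff f xs))
     \<and> (\<forall>k l. enat k < outer_len R \<and> inner_len R k = enat l \<and>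
          (pin R k l - phat R k = c *\<^sub>R (zin R k l - zhat R k) \<or> xin R k l = zin R k l) \<longrightarrow>
        xin R k l = zin R k l \<and> 0 \<in> subdiff f (xin R k l) + subdiff g (xin R k l))"
proof -
  have c: "0 < c" and \<alpha>: "0 \<le> \<alpha>" "\<alpha> < 1" and \<sigma>: "0 \<le> \<sigma>" "\<sigma> < 1" and \<rho>: "0 < \<rho>lo"
    using run unfolding admm_run_def by blast+
  have it: "alphas R k \<in> {0..\<alpha>}"
      "1 \<le> l \<Longrightarrow> enat l \<le> inner_len R k \<Longrightarrow> inner_step g F c R k l"
      "1 \<le> l \<Longrightarrow> enat l \<le> inner_len R k \<Longrightarrow> inner_test c \<sigma> R k l \<longleftrightarrow> inner_len R k = enat l"
      "enat (Suc k) < outer_len R \<longleftrightarrow> (\<exists>l. inner_len R k = enat l \<and> xin R k l \<noteq> zin R k l)"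
      "inner_len R k = enat l \<Longrightarrow> xin R k l \<noteq> zin R k l \<Longrightarrow> outer_update c \<rho>lo \<rho>hi R k l"
      "inner_len R k = enat l \<Longrightarrow> 1 \<le> l"
    if "enat k < outer_len R" for k l
    using run that unfolding admm_run_def by (auto simp: one_enat_def)
  obtain xs0 ps0 where KT0: "ps0 \<in> subdiff g xs0" "- ps0 \<in> subdiff f xs0"
  proof -
    obtain x u v where "u \<in> subdiff f x" "v \<in> subdiff g x" "0 = u + v"
      using solvable by (auto elim: set_plus_elim)
    then show thesis using that[of v x] by (metis add.inverse_unique add.commute)
  qed
  have "\<exists>xs ps. X R \<longlonglongrightarrow> xs \<and> Z R \<longlonglongrightarrow> xs \<and> 0 \<in> subdiff f xs + subdiff g xs \<and>
      P R \<longlonglongrightarrow> ps \<and> ps \<in> subdiff g xs \<and> - ps \<in> subdiff f xs"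
    if out: "outer_len R = \<infinity>"
  proof -
    have k: "enat k < outer_len R" for k by (simp add: out)
    have "\<forall>k. \<exists>l. inner_len R k = enat l \<and> xin R k l \<noteq> zin R k l"
      using it(4)[OF k] k by blast
    then obtain l where l: "\<And>k. inner_len R k = enat (l k)"
        and ne: "\<And>k. xin R k (l k) \<noteq> zin R k (l k)"
      by metis
    have l1: "1 \<le> l k" for k using it(6)[OF k l] .
    have \<alpha>_mono: "alphas R k \<le> alphas R (Suc k)" for k
      using alphas_mono k by blast
    have step: "inner_step g F c R k (l k)" for k using it(2)[OF k l1] l by simp
    have test: "inner_test c \<sigma> R k (l k)" for k using it(3)[OF k l1] l by simp
    obtain xs ps where "X R \<longlonglongrightarrow> xs" "Z R \<longlonglongrightarrow> xs" "P R \<longlonglongrightarrow> ps"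
        and ps: "ps \<in> subdiff g xs" "- ps \<in> subdiff f xs"
      by (rule infinite_outer_loop_converges[OF f g KT0 F c \<sigma> \<rho> it(1)[OF k] \<alpha>_mono \<alpha>(2)
          inertial_parameter_bound[OF \<alpha>(1) beta(2,3) rho] l1 step test ne it(5)[OF k l ne]])
    then show ?thesis using KT_pair_imp_solution[OF ps] by blast
  qed
  moreover have "\<exists>xs ps. xin R k \<longlonglongrightarrow> xs \<and> zin R k \<longlonglongrightarrow> xs \<and> 0 \<in> subdiff f xs + subdiff g xs \<and>
      pin R k \<longlonglongrightarrow> ps \<and> ps \<in> subdiff g xs \<and> - ps \<in> subdiff f xs"
    if "0 < \<sigma>" and out: "outer_len R = enat (Suc k)" and inf: "inner_len R k = \<infinity>" for k
  proof -
    have k: "enat k < outer_len R" by (simp add: out)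
    have loop: "inner_step g F c R k l" "\<not> inner_test c \<sigma> R k l" if "1 \<le> l" for l
      using it(2,3)[OF k that] inf by simp_all
    obtain xs ps where "xin R k \<longlonglongrightarrow> xs" "zin R k \<longlonglongrightarrow> xs" "pin R k \<longlonglongrightarrow> ps"
        and ps: "ps \<in> subdiff g xs" "- ps \<in> subdiff f xs"
      by (rule nonterminating_inner_loop_converges[OF f g F c \<open>0 < \<sigma>\<close> loop])
    then show ?thesis using KT_pair_imp_solution[OF ps] by blast
  qed
  moreover have "xin R k l = zin R k l \<and> 0 \<in> subdiff f (xin R k l) + subdiff g (xin R k l)"
    if k: "enat k < outer_len R" and l: "inner_len R k = enat l"
      and stop: "pin R k l - phat R k = c *\<^sub>R (zin R k l - zhat R k) \<or> xin R k l = zin R k l"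
    for k l
  proof -
    have l1: "1 \<le> l" using it(6)[OF k l] .
    have step: "inner_step g F c R k l" and test: "inner_test c \<sigma> R k l"
      using it(2,3)[OF k l1] l by simp_all
    note KT = inner_step_KT[OF f(1,2) g(1,2) F c l1 step]
    have eq: "xin R k l = zin R k l"
      using stop inner_test_residual_zero[OF KT(3) test \<sigma> c] by blast
    then show ?thesis using KT_pair_imp_solution[OF _ KT(1)] KT(2) by simp
  qed
  ultimately show ?thesis by blast
qed

end
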